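(* Let $\mathbb{X}$ be a Cartesian left additive category with a system of linearizing combinators $\mathsf{L}^{C}$. Then $\mathbb{X}$ is a Cartesian differential category with differential combinator $\mathsf{D}_\mathsf{L}$ defined on a map $f: A \to B$ by $$\mathsf{D}_\mathsf{L}[f] := \mathsf{L}^{A}\left[\oplus_A f \right].$$ Furthermore: (i) for every map $f:A \to B$, $\mathsf{D}_\mathsf{L}[f]$ is $\mathsf{L}^{A}$-linear, i.e. $\mathsf{L}^A[\mathsf{D}_\mathsf{L}[f]]=\mathsf{D}_\mathsf{L}[f]$; (ii) a map $f: C \times A \to B$ is linear in its second argument (with respect to $\mathsf{D}_\mathsf{L}$) if and only if $f$ is $\mathsf{L}^{C}$-linear, i.e. $\mathsf{L}^C[f]=f$; (iii) $\mathsf{L} = \mathsf{L}_{\mathsf{D}_\mathsf{L}}$, where for $f:A\to B$, $\mathsf{L}[f]:=\langle 0,1\rangle\,\mathsf{L}^\top[\pi_1 f]$ (with $\top$ the terminal object, $\pi_1:\top\times A\to A$, $\langle 0,1\rangle: A\to\top\times A$) and $\mathsf{L}_{\mathsf{D}_\mathsf{L}}[f]:=\langle 0,1\rangle\,\mathsf{D}_\mathsf{L}[f]$ (with $\langle 0,1\rangle:A\to A\times A$).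
   Context: Composition is in diagrammatic order: $fg$ means first $f$, then $g$; identities are written $1$. A left additive category is a category whose hom-sets are commutative monoids $(+,0)$ with $f(g+h)=fg+fh$ and $f0=0$. A map $f$ is additive if $0f=0$ and $(g+h)f=gf+hf$ for all $g,h$. A Cartesian left additive category is a left additive category with (chosen) finite products whose projections $\pi_0,\pi_1$ are additive; $\langle -,-\rangle$ is pairing, $f\times g=\langle \pi_0 f,\pi_1 g\rangle$, $\top$ is the terminal object. Put $\oplus_A:=\pi_0+\pi_1:A\times A\to A$; $\ell_{A,B,C,D}:=\langle 1,0\rangle\times\langle 0,1\rangle: A\times D\to (A\times B)\times(C\times D)$; $c_{A,B,C,D}:=\langle \pi_0\times\pi_0,\pi_1\times\pi_1\rangle:(A\times B)\times(C\times D)\to(A\times C)\times(B\times D)$ (subscripts omitted). A Cartesian differential category is a Cartesian left additive category $\mathbb{X}$ with a differential combinator $\mathsf{D}$, i.e. a family of operators $\mathsf{D}:\mathbb{X}(A,B)\to\mathbb{X}(A\times A,B)$ such that: [CD.1] $\mathsf{D}[f+g]=\mathsf{D}[f]+\mathsf{D}[g]$, $\mathsf{D}[0]=0$; [CD.2] $(1\times\oplus_A)\mathsf{D}[f]=(1\times\pi_0)\mathsf{D}[f]+(1\times\pi_1)\mathsf{D}[f]$, $\langle 1,0\rangle\mathsf{D}[f]=0$; [CD.3] $\mathsf{D}[1]=\pi_1$, $\mathsf{D}[\pi_0]=\pi_1\pi_0$, $\mathsf{D}[\pi_1]=\pi_1\pi_1$; [CD.4] $\mathsf{D}[\langle f,g\rangle]=\langle\mathsf{D}[f],\mathsf{D}[g]\rangle$;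 [CD.5] $\mathsf{D}[fg]=\langle\pi_0 f,\mathsf{D}[f]\rangle\mathsf{D}[g]$; [CD.6] $\ell\,\mathsf{D}[\mathsf{D}[f]]=\mathsf{D}[f]$; [CD.7] $c\,\mathsf{D}[\mathsf{D}[f]]=\mathsf{D}[\mathsf{D}[f]]$. For $f:C\times A\to B$ put $\mathsf{D}^C[f]:=\langle 1\times\pi_0,0\times\pi_1\rangle\mathsf{D}[f]: C\times(A\times A)\to B$; $f$ is linear in its second argument if $\mathsf{D}^C[f]=(1\times\pi_1)f$. A system of linearizing combinators on a Cartesian left additive category $\mathbb{X}$ is a family, indexed by objects $C$, of operators $\mathsf{L}^C:\mathbb{X}(C\times A,B)\to\mathbb{X}(C\times A,B)$ such that: [L.1] $\mathsf{L}^{C}[f+g]=\mathsf{L}^{C}[f]+\mathsf{L}^{C}[g]$, $\mathsf{L}^{C}[0]=0$; [L.2] $(1\times\oplus_A)\mathsf{L}^{C}[f]=(1\times\pi_0)\mathsf{L}^{C}[f]+(1\times\pi_1)\mathsf{L}^{C}[f]$, $\langle\pi_0,0\rangle\mathsf{L}^{C}[f]=0$; [L.3] $\mathsf{L}^{C}[\pi_1]=\pi_1$, $\mathsf{L}^{C}[\pi_1\pi_0]=\pi_1\pi_0$, $\mathsf{L}^{C}[\pi_1\pi_1]=\pi_1\pi_1$; [L.4] $\mathsf{L}^{C}[\langle f,g\rangle]=\langle\mathsf{L}^{C}[f],\mathsf{L}^{C}[g]\rangle$; [L.5] for $f:C\times A\to B$, $g:C\times B\to D$, $\mathsf{L}^{C}[\langle\pi_0,f\rangle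 g]=\langle\pi_0,\mathsf{L}^{C}[f]\rangle\,\mathsf{L}^{C}[\langle\pi_0,\pi_1+\langle\pi_0,0\rangle f\rangle g]$; [L.6] $\mathsf{L}^{C}[\mathsf{L}^{C}[f]]=\mathsf{L}^{C}[f]$; [L.7] with the isomorphisms $\alpha=\langle 1\times\pi_0,\pi_1\pi_1\rangle:C\times(A\times B)\to(C\times A)\times B$ and $\beta=\langle 1\times\pi_1,\pi_1\pi_0\rangle:C\times(A\times B)\to(C\times B)\times A$, and for $f:C\times(A\times B)\to D$, $\mathsf{L}^C_0[f]:=\beta\,\mathsf{L}^{C\times B}[\beta^{-1}f]$, $\mathsf{L}^C_1[f]:=\alpha\,\mathsf{L}^{C\times A}[\alpha^{-1}f]$, one has $\mathsf{L}^C_1[\mathsf{L}^C_0[f]]=\mathsf{L}^C_0[\mathsf{L}^C_1[f]]$; [L.8] for every $h:C'\to C$ and $f:C\times A\to B$, $(h\times 1)\mathsf{L}^{C}[f]=\mathsf{L}^{C'}[(h\times 1)f]$. *)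

theory Defs
  imports Main
begin

text \<open>
  Categories are given by a set of objects and a set of arrows with domain and codomain, so that
  hom-sets are pairwise disjoint.  Composition is diagrammatic: \<open>f \<cdot> g\<close> is
  first \<open>f\<close>, then \<open>g\<close>.  Operations are only constrained on well-typed arguments.
  Since a product object need not determine its factors, projections and linearizing combinators
  carry the factors as explicit arguments.
\<close>

record ('o, 'm) category_data =
  Obj :: "'o set"
  Arr :: "'m set"
  Dom :: "'m \<Rightarrow> 'o"
  Cod :: "'m \<Rightarrow> 'o"
  ident :: "'o \<Rightarrow> 'm"  ("\<one>\<index>")
  cmp :: "'m \<Rightarrow> 'm \<Rightarrow> 'm"  (infixl "\<cdot>\<index>" 70)

definition hom_set :: "('o, 'm, 'r) category_data_scheme \<Rightarrow> 'o \<Rightarrow> 'o \<Rightarrow> 'm set"  ("Hom\<index>")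
  where "hom_set X A B = {f \<in> Arr X. Dom X f = A \<and> Cod X f = B}"

locale category =
  fixes X :: "('o, 'm, 'r) category_data_scheme"  (structure)
  assumes Dom_in_Obj: "f \<in> Arr X \<Longrightarrow> Dom X f \<in> Obj X"
    and Cod_in_Obj: "f \<in> Arr X \<Longrightarrow> Cod X f \<in> Obj X"
    and ident_in_Hom: "A \<in> Obj X \<Longrightarrow> \<one> A \<in> Hom A A"
    and cmp_in_Hom: "f \<in> Hom A B \<Longrightarrow> g \<in> Hom B C \<Longrightarrow> f \<cdot> g \<in> Hom A C"
    and ident_cmp: "f \<in> Hom A B \<Longrightarrow> \<one> A \<cdot> f = f"
    and cmp_ident: "f \<in> Hom A B \<Longrightarrow> f \<cdot> \<one> B = f"
    and cmp_assoc: "f \<in> Hom A B \<Longrightarrow> g \<in> Hom B C \<Longrightarrow> h \<in> Hom C E \<Longrightarrow>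
      (f \<cdot> g) \<cdot> h = f \<cdot> (g \<cdot> h)"

definition inverse_arr :: "('o, 'm, 'r) category_data_scheme \<Rightarrow> 'm \<Rightarrow> 'm"
  where "inverse_arr X f = (THE g. g \<in> Hom\<^bsub>X\<^esub> (Cod X f) (Dom X f) \<and>
    f \<cdot>\<^bsub>X\<^esub> g = \<one>\<^bsub>X\<^esub> (Dom X f) \<and> g \<cdot>\<^bsub>X\<^esub> f = \<one>\<^bsub>X\<^esub> (Cod X f))"

record ('o, 'm) left_additive_data = "('o, 'm) category_data" +
  plus_arr :: "'m \<Rightarrow> 'm \<Rightarrow> 'm"  (infixl "\<boxplus>\<index>" 65)
  zero_arr :: "'o \<Rightarrow> 'o \<Rightarrow> 'm"  ("\<zero>\<index>")

locale left_additive_category = category X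
  for X :: "('o, 'm, 'r) left_additive_data_scheme"  (structure) +
  assumes plus_in_Hom: "f \<in> Hom A B \<Longrightarrow> g \<in> Hom A B \<Longrightarrow> f \<boxplus> g \<in> Hom A B"
    and zero_in_Hom: "A \<in> Obj X \<Longrightarrow> B \<in> Obj X \<Longrightarrow> \<zero> A B \<in> Hom A B"
    and plus_assoc: "f \<in> Hom A B \<Longrightarrow> g \<in> Hom A B \<Longrightarrow> h \<in> Hom A B \<Longrightarrow>
      (f \<boxplus> g) \<boxplus> h = f \<boxplus> (g \<boxplus> h)"
    and plus_commute: "f \<in> Hom A B \<Longrightarrow> g \<in> Hom A B \<Longrightarrow> f \<boxplus> g = g \<boxplus> f"
    and zero_plus: "f \<in> Hom A B \<Longrightarrow> \<zero> A B \<boxplus> f = f"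
    and cmp_plus: "f \<in> Hom A B \<Longrightarrow> g \<in> Hom B C \<Longrightarrow> h \<in> Hom B C \<Longrightarrow>
      f \<cdot> (g \<boxplus> h) = f \<cdot> g \<boxplus> f \<cdot> h"
    and cmp_zero: "f \<in> Hom A B \<Longrightarrow> C \<in> Obj X \<Longrightarrow> f \<cdot> \<zero> B C = \<zero> A C"

definition additive_arr :: "('o, 'm, 'r) left_additive_data_scheme \<Rightarrow> 'm \<Rightarrow> bool"
  where "additive_arr X f \<longleftrightarrow> f \<in> Arr X \<and> (\<forall>C \<in> Obj X.
    \<zero>\<^bsub>X\<^esub> C (Dom X f) \<cdot>\<^bsub>X\<^esub> f = \<zero>\<^bsub>X\<^esub> C (Cod X f) \<and>
    (\<forall>g \<in> Hom\<^bsub>X\<^esub> C (Dom X f). \<forall>h \<in> Hom\<^bsub>X\<^esub> C (Dom X f).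
      (g \<boxplus>\<^bsub>X\<^esub> h) \<cdot>\<^bsub>X\<^esub> f = g \<cdot>\<^bsub>X\<^esub> f \<boxplus>\<^bsub>X\<^esub> h \<cdot>\<^bsub>X\<^esub> f))"

record ('o, 'm) cartesian_left_additive_data = "('o, 'm) left_additive_data" +
  prod_obj :: "'o \<Rightarrow> 'o \<Rightarrow> 'o"  (infixr "\<otimes>\<index>" 80)
  proj0 :: "'o \<Rightarrow> 'o \<Rightarrow> 'm"  ("\<pi>\<^sub>0\<index>")
  proj1 :: "'o \<Rightarrow> 'o \<Rightarrow> 'm"  ("\<pi>\<^sub>1\<index>")
  pairing :: "'m \<Rightarrow> 'm \<Rightarrow> 'm"  ("\<langle>_, _\<rangle>\<index>")
  Terminal :: 'o  ("\<top>\<index>")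

locale cartesian_left_additive_category = left_additive_category X
  for X :: "('o, 'm, 'r) cartesian_left_additive_data_scheme"  (structure) +
  assumes prod_in_Obj: "A \<in> Obj X \<Longrightarrow> B \<in> Obj X \<Longrightarrow> A \<otimes> B \<in> Obj X"
    and proj0_in_Hom: "A \<in> Obj X \<Longrightarrow> B \<in> Obj X \<Longrightarrow> \<pi>\<^sub>0 A B \<in> Hom (A \<otimes> B) A"
    and proj1_in_Hom: "A \<in> Obj X \<Longrightarrow> B \<in> Obj X \<Longrightarrow> \<pi>\<^sub>1 A B \<in> Hom (A \<otimes> B) B"
    and pairing_in_Hom: "f \<in> Hom C A \<Longrightarrow> g \<in> Hom C B \<Longrightarrow> \<langle>f, g\<rangle> \<in> Hom C (A \<otimes> B)"
    and pairing_proj0: "f \<in> Hom C A \<Longrightarrow> g \<in> Hom C B \<Longrightarrow> \<langle>f, g\<rangle> \<cdot> \<pi>\<^sub>0 A B = f"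
    and pairing_proj1: "f \<in> Hom C A \<Longrightarrow> g \<in> Hom C B \<Longrightarrow> \<langle>f, g\<rangle> \<cdot> \<pi>\<^sub>1 A B = g"
    and pairing_unique: "A \<in> Obj X \<Longrightarrow> B \<in> Obj X \<Longrightarrow> h \<in> Hom C (A \<otimes> B) \<Longrightarrow>
      \<langle>h \<cdot> \<pi>\<^sub>0 A B, h \<cdot> \<pi>\<^sub>1 A B\<rangle> = h"
    and Terminal_in_Obj: "\<top> \<in> Obj X"
    and Terminal_universal: "A \<in> Obj X \<Longrightarrow> \<exists>!t. t \<in> Hom A \<top>"
    and proj0_additive: "A \<in> Obj X \<Longrightarrow> B \<in> Obj X \<Longrightarrow> additive_arr X (\<pi>\<^sub>0 A B)"
    and proj1_additive: "A \<in> Obj X \<Longrightarrow> B \<in> Obj X \<Longrightarrow> additive_arr X (\<pi>\<^sub>1 A B)"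

definition prod_arr :: "('o, 'm, 'r) cartesian_left_additive_data_scheme \<Rightarrow> 'm \<Rightarrow> 'm \<Rightarrow> 'm"
    (infixr "\<boxtimes>\<index>" 80)
  where "f \<boxtimes>\<^bsub>X\<^esub> g = \<langle>\<pi>\<^sub>0\<^bsub>X\<^esub> (Dom X f) (Dom X g) \<cdot>\<^bsub>X\<^esub> f, \<pi>\<^sub>1\<^bsub>X\<^esub> (Dom X f) (Dom X g) \<cdot>\<^bsub>X\<^esub> g\<rangle>\<^bsub>X\<^esub>"

definition sum_arr :: "('o, 'm, 'r) cartesian_left_additive_data_scheme \<Rightarrow> 'o \<Rightarrow> 'm"  ("\<oplus>\<index>")
  where "\<oplus>\<^bsub>X\<^esub> A = \<pi>\<^sub>0\<^bsub>X\<^esub> A A \<boxplus>\<^bsub>X\<^esub> \<pi>\<^sub>1\<^bsub>X\<^esub> A A"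

definition lift_arr ::
    "('o, 'm, 'r) cartesian_left_additive_data_scheme \<Rightarrow> 'o \<Rightarrow> 'o \<Rightarrow> 'o \<Rightarrow> 'o \<Rightarrow> 'm"  ("\<ell>\<index>")
  where "\<ell>\<^bsub>X\<^esub> A B C E = \<langle>\<one>\<^bsub>X\<^esub> A, \<zero>\<^bsub>X\<^esub> A B\<rangle>\<^bsub>X\<^esub> \<boxtimes>\<^bsub>X\<^esub> \<langle>\<zero>\<^bsub>X\<^esub> E C, \<one>\<^bsub>X\<^esub> E\<rangle>\<^bsub>X\<^esub>"

definition interchange_arr ::
    "('o, 'm, 'r) cartesian_left_additive_data_scheme \<Rightarrow> 'o \<Rightarrow> 'o \<Rightarrow> 'o \<Rightarrow> 'o \<Rightarrow> 'm"  ("\<c>\<index>")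
  where "\<c>\<^bsub>X\<^esub> A B C E =
    \<langle>\<pi>\<^sub>0\<^bsub>X\<^esub> A B \<boxtimes>\<^bsub>X\<^esub> \<pi>\<^sub>0\<^bsub>X\<^esub> C E, \<pi>\<^sub>1\<^bsub>X\<^esub> A B \<boxtimes>\<^bsub>X\<^esub> \<pi>\<^sub>1\<^bsub>X\<^esub> C E\<rangle>\<^bsub>X\<^esub>"

locale cartesian_differential_category = cartesian_left_additive_category X
  for X :: "('o, 'm, 'r) cartesian_left_additive_data_scheme"  (structure)
    and D :: "'m \<Rightarrow> 'm" +
  assumes D_in_Hom: "f \<in> Hom A B \<Longrightarrow> D f \<in> Hom (A \<otimes> A) B"
    and CD1_plus: "f \<in> Hom A B \<Longrightarrow> g \<in> Hom A B \<Longrightarrow> D (f \<boxplus> g) = D f \<boxplus> D g"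
    and CD1_zero: "A \<in> Obj X \<Longrightarrow> B \<in> Obj X \<Longrightarrow> D (\<zero> A B) = \<zero> (A \<otimes> A) B"
    and CD2_plus: "f \<in> Hom A B \<Longrightarrow>
      (\<one> A \<boxtimes> \<oplus> A) \<cdot> D f = (\<one> A \<boxtimes> \<pi>\<^sub>0 A A) \<cdot> D f \<boxplus> (\<one> A \<boxtimes> \<pi>\<^sub>1 A A) \<cdot> D f"
    and CD2_zero: "f \<in> Hom A B \<Longrightarrow> \<langle>\<one> A, \<zero> A A\<rangle> \<cdot> D f = \<zero> A B"
    and CD3_ident: "A \<in> Obj X \<Longrightarrow> D (\<one> A) = \<pi>\<^sub>1 A A"
    and CD3_proj0: "A \<in> Obj X \<Longrightarrow> B \<in> Obj X \<Longrightarrow>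
      D (\<pi>\<^sub>0 A B) = \<pi>\<^sub>1 (A \<otimes> B) (A \<otimes> B) \<cdot> \<pi>\<^sub>0 A B"
    and CD3_proj1: "A \<in> Obj X \<Longrightarrow> B \<in> Obj X \<Longrightarrow>
      D (\<pi>\<^sub>1 A B) = \<pi>\<^sub>1 (A \<otimes> B) (A \<otimes> B) \<cdot> \<pi>\<^sub>1 A B"
    and CD4: "f \<in> Hom A B \<Longrightarrow> g \<in> Hom A C \<Longrightarrow> D \<langle>f, g\<rangle> = \<langle>D f, D g\<rangle>"
    and CD5: "f \<in> Hom A B \<Longrightarrow> g \<in> Hom B C \<Longrightarrow> D (f \<cdot> g) = \<langle>\<pi>\<^sub>0 A A \<cdot> f, D f\<rangle> \<cdot> D g"
    and CD6: "f \<in> Hom A B \<Longrightarrow> \<ell> A A A A \<cdot> D (D f) = D f"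
    and CD7: "f \<in> Hom A B \<Longrightarrow> \<c> A A A A \<cdot> D (D f) = D (D f)"

text \<open>
  Partial derivative and linearity in the second argument, for \<open>f : C \<otimes> A \<rightarrow> B\<close>.
\<close>

definition partial_D ::
    "('o, 'm, 'r) cartesian_left_additive_data_scheme \<Rightarrow> ('m \<Rightarrow> 'm) \<Rightarrow> 'o \<Rightarrow> 'o \<Rightarrow> 'm \<Rightarrow> 'm"
  where "partial_D X D C A f =
    \<langle>\<one>\<^bsub>X\<^esub> C \<boxtimes>\<^bsub>X\<^esub> \<pi>\<^sub>0\<^bsub>X\<^esub> A A, \<zero>\<^bsub>X\<^esub> C C \<boxtimes>\<^bsub>X\<^esub> \<pi>\<^sub>1\<^bsub>X\<^esub> A A\<rangle>\<^bsub>X\<^esub> \<cdot>\<^bsub>X\<^esub> D f"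

definition linear_in_second ::
    "('o, 'm, 'r) cartesian_left_additive_data_scheme \<Rightarrow> ('m \<Rightarrow> 'm) \<Rightarrow> 'o \<Rightarrow> 'o \<Rightarrow> 'm \<Rightarrow> bool"
  where "linear_in_second X D C A f \<longleftrightarrow>
    partial_D X D C A f = (\<one>\<^bsub>X\<^esub> C \<boxtimes>\<^bsub>X\<^esub> \<pi>\<^sub>1\<^bsub>X\<^esub> A A) \<cdot>\<^bsub>X\<^esub> f"

definition alpha_arr ::
    "('o, 'm, 'r) cartesian_left_additive_data_scheme \<Rightarrow> 'o \<Rightarrow> 'o \<Rightarrow> 'o \<Rightarrow> 'm"  ("\<alpha>\<index>")
  where "\<alpha>\<^bsub>X\<^esub> C A B =
    \<langle>\<one>\<^bsub>X\<^esub> C \<boxtimes>\<^bsub>X\<^esub> \<pi>\<^sub>0\<^bsub>X\<^esub> A B, \<pi>\<^sub>1\<^bsub>X\<^esub> C (A \<otimes>\<^bsub>X\<^esub> B) \<cdot>\<^bsub>X\<^esub> \<pi>\<^sub>1\<^bsub>X\<^esub> A B\<rangle>\<^bsub>X\<^esub>"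

definition beta_arr ::
    "('o, 'm, 'r) cartesian_left_additive_data_scheme \<Rightarrow> 'o \<Rightarrow> 'o \<Rightarrow> 'o \<Rightarrow> 'm"  ("\<beta>\<index>")
  where "\<beta>\<^bsub>X\<^esub> C A B =
    \<langle>\<one>\<^bsub>X\<^esub> C \<boxtimes>\<^bsub>X\<^esub> \<pi>\<^sub>1\<^bsub>X\<^esub> A B, \<pi>\<^sub>1\<^bsub>X\<^esub> C (A \<otimes>\<^bsub>X\<^esub> B) \<cdot>\<^bsub>X\<^esub> \<pi>\<^sub>0\<^bsub>X\<^esub> A B\<rangle>\<^bsub>X\<^esub>"

text \<open>
  A combinator \<open>L C A\<close> acts on arrows \<open>C \<otimes> A \<rightarrow> B\<close>; the codomain
  \<open>B\<close> is determined by the arrow.  Below, \<open>f : C \<otimes> (A \<otimes> B) \<rightarrow> E\<close>.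
\<close>

definition L_first ::
    "('o, 'm, 'r) cartesian_left_additive_data_scheme \<Rightarrow> ('o \<Rightarrow> 'o \<Rightarrow> 'm \<Rightarrow> 'm) \<Rightarrow>
      'o \<Rightarrow> 'o \<Rightarrow> 'o \<Rightarrow> 'm \<Rightarrow> 'm"
  where "L_first X L C A B f =
    \<beta>\<^bsub>X\<^esub> C A B \<cdot>\<^bsub>X\<^esub> L (C \<otimes>\<^bsub>X\<^esub> B) A (inverse_arr X (\<beta>\<^bsub>X\<^esub> C A B) \<cdot>\<^bsub>X\<^esub> f)"

definition L_second ::
    "('o, 'm, 'r) cartesian_left_additive_data_scheme \<Rightarrow> ('o \<Rightarrow> 'o \<Rightarrow> 'm \<Rightarrow> 'm) \<Rightarrow>
      'o \<Rightarrow> 'o \<Rightarrow> 'o \<Rightarrow> 'm \<Rightarrow> 'm"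
  where "L_second X L C A B f =
    \<alpha>\<^bsub>X\<^esub> C A B \<cdot>\<^bsub>X\<^esub> L (C \<otimes>\<^bsub>X\<^esub> A) B (inverse_arr X (\<alpha>\<^bsub>X\<^esub> C A B) \<cdot>\<^bsub>X\<^esub> f)"

locale system_of_linearizing_combinators = cartesian_left_additive_category X
  for X :: "('o, 'm, 'r) cartesian_left_additive_data_scheme"  (structure)
    and L :: "'o \<Rightarrow> 'o \<Rightarrow> 'm \<Rightarrow> 'm" +
  assumes L_in_Hom: "C \<in> Obj X \<Longrightarrow> A \<in> Obj X \<Longrightarrow> f \<in> Hom (C \<otimes> A) B \<Longrightarrow> L C A f \<in> Hom (C \<otimes> A) B"
    and L1_plus: "C \<in> Obj X \<Longrightarrow> A \<in> Obj X \<Longrightarrow> f \<in> Hom (C \<otimes> A) B \<Longrightarrow> g \<in> Hom (C \<otimes> A) B \<Longrightarrow>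
      L C A (f \<boxplus> g) = L C A f \<boxplus> L C A g"
    and L1_zero: "C \<in> Obj X \<Longrightarrow> A \<in> Obj X \<Longrightarrow> B \<in> Obj X \<Longrightarrow>
      L C A (\<zero> (C \<otimes> A) B) = \<zero> (C \<otimes> A) B"
    and L2_plus: "C \<in> Obj X \<Longrightarrow> A \<in> Obj X \<Longrightarrow> f \<in> Hom (C \<otimes> A) B \<Longrightarrow>
      (\<one> C \<boxtimes> \<oplus> A) \<cdot> L C A f = (\<one> C \<boxtimes> \<pi>\<^sub>0 A A) \<cdot> L C A f \<boxplus> (\<one> C \<boxtimes> \<pi>\<^sub>1 A A) \<cdot> L C A f"
    and L2_zero: "C \<in> Obj X \<Longrightarrow> A \<in> Obj X \<Longrightarrow> f \<in> Hom (C \<otimes> A) B \<Longrightarrow>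
      \<langle>\<pi>\<^sub>0 C A, \<zero> (C \<otimes> A) A\<rangle> \<cdot> L C A f = \<zero> (C \<otimes> A) B"
    and L3: "C \<in> Obj X \<Longrightarrow> A \<in> Obj X \<Longrightarrow> L C A (\<pi>\<^sub>1 C A) = \<pi>\<^sub>1 C A"
    and L3_proj0: "C \<in> Obj X \<Longrightarrow> A \<in> Obj X \<Longrightarrow> B \<in> Obj X \<Longrightarrow>
      L C (A \<otimes> B) (\<pi>\<^sub>1 C (A \<otimes> B) \<cdot> \<pi>\<^sub>0 A B) = \<pi>\<^sub>1 C (A \<otimes> B) \<cdot> \<pi>\<^sub>0 A B"
    and L3_proj1: "C \<in> Obj X \<Longrightarrow> A \<in> Obj X \<Longrightarrow> B \<in> Obj X \<Longrightarrow>
      L C (A \<otimes> B) (\<pi>\<^sub>1 C (A \<otimes> B) \<cdot> \<pi>\<^sub>1 A B) = \<pi>\<^sub>1 C (A \<otimes> B) \<cdot> \<pi>\<^sub>1 A B"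
    and L4: "C \<in> Obj X \<Longrightarrow> A \<in> Obj X \<Longrightarrow> f \<in> Hom (C \<otimes> A) B \<Longrightarrow> g \<in> Hom (C \<otimes> A) E \<Longrightarrow>
      L C A \<langle>f, g\<rangle> = \<langle>L C A f, L C A g\<rangle>"
    and L5: "C \<in> Obj X \<Longrightarrow> A \<in> Obj X \<Longrightarrow> B \<in> Obj X \<Longrightarrow>
      f \<in> Hom (C \<otimes> A) B \<Longrightarrow> g \<in> Hom (C \<otimes> B) E \<Longrightarrow>
      L C A (\<langle>\<pi>\<^sub>0 C A, f\<rangle> \<cdot> g) =
        \<langle>\<pi>\<^sub>0 C A, L C A f\<rangle> \<cdot>
          L C B (\<langle>\<pi>\<^sub>0 C B, \<pi>\<^sub>1 C B \<boxplus> \<langle>\<pi>\<^sub>0 C B, \<zero> (C \<otimes> B) A\<rangle> \<cdot> f\<rangle> \<cdot> g)"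
    and L6: "C \<in> Obj X \<Longrightarrow> A \<in> Obj X \<Longrightarrow> f \<in> Hom (C \<otimes> A) B \<Longrightarrow> L C A (L C A f) = L C A f"
    and L7: "C \<in> Obj X \<Longrightarrow> A \<in> Obj X \<Longrightarrow> B \<in> Obj X \<Longrightarrow> f \<in> Hom (C \<otimes> (A \<otimes> B)) E \<Longrightarrow>
      L_second X L C A B (L_first X L C A B f) = L_first X L C A B (L_second X L C A B f)"
    and L8: "C \<in> Obj X \<Longrightarrow> A \<in> Obj X \<Longrightarrow> h \<in> Hom C' C \<Longrightarrow> f \<in> Hom (C \<otimes> A) B \<Longrightarrow>
      (h \<boxtimes> \<one> A) \<cdot> L C A f = L C' A ((h \<boxtimes> \<one> A) \<cdot> f)"

definition D_of_L ::
    "('o, 'm, 'r) cartesian_left_additive_data_scheme \<Rightarrow> ('o \<Rightarrow> 'o \<Rightarrow> 'm \<Rightarrow> 'm) \<Rightarrow> 'm \<Rightarrow> 'm"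
  where "D_of_L X L f = L (Dom X f) (Dom X f) (\<oplus>\<^bsub>X\<^esub> (Dom X f) \<cdot>\<^bsub>X\<^esub> f)"

definition total_L ::
    "('o, 'm, 'r) cartesian_left_additive_data_scheme \<Rightarrow> ('o \<Rightarrow> 'o \<Rightarrow> 'm \<Rightarrow> 'm) \<Rightarrow> 'm \<Rightarrow> 'm"
  where "total_L X L f = \<langle>\<zero>\<^bsub>X\<^esub> (Dom X f) \<top>\<^bsub>X\<^esub>, \<one>\<^bsub>X\<^esub> (Dom X f)\<rangle>\<^bsub>X\<^esub> \<cdot>\<^bsub>X\<^esub>
    L \<top>\<^bsub>X\<^esub> (Dom X f) (\<pi>\<^sub>1\<^bsub>X\<^esub> \<top>\<^bsub>X\<^esub> (Dom X f) \<cdot>\<^bsub>X\<^esub> f)"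

definition L_of_D ::
    "('o, 'm, 'r) cartesian_left_additive_data_scheme \<Rightarrow> ('m \<Rightarrow> 'm) \<Rightarrow> 'm \<Rightarrow> 'm"
  where "L_of_D X D f = \<langle>\<zero>\<^bsub>X\<^esub> (Dom X f) (Dom X f), \<one>\<^bsub>X\<^esub> (Dom X f)\<rangle>\<^bsub>X\<^esub> \<cdot>\<^bsub>X\<^esub> D f"

end

theory Submission
  imports Defs
begin

text \<open>
  Write \<open>L\<^sup>C[y \<mapsto> F(c, y)](a)\<close> for the value at \<open>a\<close> of the linearization of
  \<open>F : C \<otimes> A \<rightarrow> B\<close> in its second argument, with \<open>c\<close> as a parameter.  In this notation
  \<open>D f (x, a) = L[y \<mapsto> f(x + y)](a)\<close>: the derivative of \<open>f\<close> at \<open>x\<close> is the linearization at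
  zero of \<open>f\<close> translated by \<open>x\<close>.  Variables such as \<open>c\<close>, \<open>x\<close>, \<open>a\<close> stand for arrows out of
  an arbitrary object \<open>T\<close>; taking them to be the projections from a product of the objects of
  the variables turns an identity between such values into an identity between arrows.

  Most axioms of a differential combinator are translations of the axioms for \<open>L\<close>.  The chain rule
  for \<open>L\<close> turns \<open>D (f \<cdot> g) (x, a)\<close> into \<open>L[z \<mapsto> g(f x + z)](D f (x, a))\<close>, which is the chain rule for
  \<open>D\<close> because \<open>L\<close> commutes with reparametrization along \<open>f\<close> (\<open>D_cmp\<close>).  The chain rule also
  shows that constants linearize to zero (\<open>L_constant\<close>) and that linearizing jointly in a pair
  and then setting one component to zero is the same as linearizing in the other component alone
  (\<open>L_partial0\<close>, \<open>L_partial1\<close>).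

  The remaining axioms and the characterization of linearity rest on one observation
  (\<open>D_partial1_linear\<close>): if \<open>L\<^sup>C[F] = F\<close>, then \<open>F\<close> is additive in its second argument, so
  \<open>F(c, x + v) = F(c, x) + F(c, v)\<close> is the sum of a term constant in \<open>v\<close> and a linear one, and hence
  \<open>D F ((c, x), (0, a)) = F(c, a)\<close>.  Idempotence of \<open>L\<close> makes \<open>D f\<close> such an \<open>F\<close>.  Therefore
  \<open>D (D f) ((x, b), (0, a)) = D f (x, a)\<close>, whose case \<open>b = 0\<close> is the lifting axiom, and
  \<open>D (D f) ((x, b), (y, a)) = D (D f) ((x, b), (y, 0)) + D f (x, a)\<close>.  In this sum the first term is
  \<open>L[u \<mapsto> L[v \<mapsto> f(x + u + v)](b)](y)\<close>; its symmetry in \<open>b\<close> and \<open>y\<close> is exactly what the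
  interchange of linearizations in two variables provides (\<open>mixed_partials_commute\<close>).
\<close>

section \<open>Computing with arrows of a Cartesian left additive category\<close>

context category
begin

text \<open>
  A typing premise \<open>f \<in> Hom A B\<close> mentions objects that need not occur in a rewrite rule's
  left-hand side.  The simplification rules below therefore state typing through \<open>Arr\<close>, \<open>Dom\<close>
  and \<open>Cod\<close>, which the simplifier can compute from the arrows themselves.
\<close>

lemma mem_Hom_iff: "f \<in> Hom A B \<longleftrightarrow> f \<in> Arr X \<and> Dom X f = A \<and> Cod X f = B"
  by (auto simp: hom_set_def)

lemma Dom_Obj [simp]: "f \<in> Arr X \<Longrightarrow> Dom X f \<in> Obj X"
  and Cod_Obj [simp]: "f \<in> Arr X \<Longrightarrow> Cod X f \<in> Obj X"
  by (fact Dom_in_Obj, fact Cod_in_Obj)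

lemma ident_typing [simp]:
  assumes "A \<in> Obj X"
  shows "\<one> A \<in> Arr X" "Dom X (\<one> A) = A" "Cod X (\<one> A) = A"
  using ident_in_Hom[OF assms] by (simp_all add: mem_Hom_iff)

lemma cmp_typing [simp]:
  assumes "f \<in> Arr X" "g \<in> Arr X" "Cod X f = Dom X g"
  shows "f \<cdot> g \<in> Arr X" "Dom X (f \<cdot> g) = Dom X f" "Cod X (f \<cdot> g) = Cod X g"
  using cmp_in_Hom[of f "Dom X f" "Cod X f" g "Cod X g"] assms by (simp_all add: mem_Hom_iff)

lemma ident_cmp' [simp]: "f \<in> Arr X \<Longrightarrow> Dom X f = A \<Longrightarrow> \<one> A \<cdot> f = f"
  using ident_cmp by (auto simp: mem_Hom_iff)

lemma cmp_ident' [simp]: "f \<in> Arr X \<Longrightarrow> Cod X f = B \<Longrightarrow> f \<cdot> \<one> B = f"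
  using cmp_ident by (auto simp: mem_Hom_iff)

lemma cmp_assoc' [simp]:
  "f \<in> Arr X \<Longrightarrow> g \<in> Arr X \<Longrightarrow> h \<in> Arr X \<Longrightarrow> Cod X f = Dom X g \<Longrightarrow> Cod X g = Dom X h \<Longrightarrow>
    (f \<cdot> g) \<cdot> h = f \<cdot> (g \<cdot> h)"
  using cmp_assoc[of f "Dom X f" "Cod X f" g "Cod X g" h "Cod X h"] by (simp add: mem_Hom_iff)

lemma inverse_arr_eqI:
  assumes f: "f \<in> Hom A B" and g: "g \<in> Hom B A" and fg: "f \<cdot> g = \<one> A" and gf: "g \<cdot> f = \<one> B"
  shows "inverse_arr X f = g"
  unfolding inverse_arr_def
proof (rule the_equality)
  show "g \<in> Hom (Cod X f) (Dom X f) \<and> f \<cdot> g = \<one> (Dom X f) \<and> g \<cdot> f = \<one> (Cod X f)"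
    using assms by (simp add: mem_Hom_iff)
next
  fix h
  assume "h \<in> Hom (Cod X f) (Dom X f) \<and> f \<cdot> h = \<one> (Dom X f) \<and> h \<cdot> f = \<one> (Cod X f)"
  then have h: "h \<in> Hom B A" and hf: "h \<cdot> f = \<one> B"
    using f by (simp_all add: mem_Hom_iff)
  have "h = h \<cdot> (f \<cdot> g)"
    using h fg by (simp add: mem_Hom_iff)
  also have "\<dots> = (h \<cdot> f) \<cdot> g"
    using cmp_assoc[OF h f g] by simp
  also have "\<dots> = g"
    using g hf by (simp add: mem_Hom_iff)
  finally show "h = g" .
qed

end

context left_additive_category
begin

lemma plus_typing [simp]:
  assumes "f \<in> Arr X" "g \<in> Arr X" "Dom X f = Dom X g" "Cod X f = Cod X g"
  shows "f \<boxplus> g \<in> Arr X" "Dom X (f \<boxplus> g) = Dom X g" "Cod X (f \<boxplus> g) = Cod X g"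
  using plus_in_Hom[of f "Dom X f" "Cod X f" g] assms by (simp_all add: mem_Hom_iff)

lemma zero_typing [simp]:
  assumes "A \<in> Obj X" "B \<in> Obj X"
  shows "\<zero> A B \<in> Arr X" "Dom X (\<zero> A B) = A" "Cod X (\<zero> A B) = B"
  using zero_in_Hom[OF assms] by (simp_all add: mem_Hom_iff)

lemma zero_plus' [simp]: "f \<in> Arr X \<Longrightarrow> Dom X f = A \<Longrightarrow> Cod X f = B \<Longrightarrow> \<zero> A B \<boxplus> f = f"
  using zero_plus by (auto simp: mem_Hom_iff)

lemma plus_zero' [simp]: "f \<in> Arr X \<Longrightarrow> Dom X f = A \<Longrightarrow> Cod X f = B \<Longrightarrow> f \<boxplus> \<zero> A B = f"
  using zero_plus'[of f A B] plus_commute[of f A B "\<zero> A B"] by (auto simp: mem_Hom_iff)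

lemma plus_assoc':
  "f \<in> Arr X \<Longrightarrow> g \<in> Arr X \<Longrightarrow> h \<in> Arr X \<Longrightarrow> Dom X f = Dom X g \<Longrightarrow> Dom X g = Dom X h \<Longrightarrow>
    Cod X f = Cod X g \<Longrightarrow> Cod X g = Cod X h \<Longrightarrow> (f \<boxplus> g) \<boxplus> h = f \<boxplus> (g \<boxplus> h)"
  using plus_assoc by (simp add: mem_Hom_iff)

lemma plus_commute':
  "f \<in> Arr X \<Longrightarrow> g \<in> Arr X \<Longrightarrow> Dom X f = Dom X g \<Longrightarrow> Cod X f = Cod X g \<Longrightarrow> f \<boxplus> g = g \<boxplus> f"
  using plus_commute by (simp add: mem_Hom_iff)

lemma plus_left_commute':
  "f \<in> Arr X \<Longrightarrow> g \<in> Arr X \<Longrightarrow> h \<in> Arr X \<Longrightarrow> Dom X f = Dom X g \<Longrightarrow> Dom X g = Dom X h \<Longrightarrow>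
    Cod X f = Cod X g \<Longrightarrow> Cod X g = Cod X h \<Longrightarrow> f \<boxplus> (g \<boxplus> h) = g \<boxplus> (f \<boxplus> h)"
  using plus_assoc'[of f g h] plus_assoc'[of g f h] plus_commute'[of f g] by simp

lemmas plus_ac = plus_assoc' plus_commute' plus_left_commute'

lemma cmp_plus' [simp]:
  "f \<in> Arr X \<Longrightarrow> g \<in> Arr X \<Longrightarrow> h \<in> Arr X \<Longrightarrow> Cod X f = Dom X g \<Longrightarrow> Dom X g = Dom X h \<Longrightarrow>
    Cod X g = Cod X h \<Longrightarrow> f \<cdot> (g \<boxplus> h) = f \<cdot> g \<boxplus> f \<cdot> h"
  using cmp_plus[of f "Dom X f" "Cod X f" g "Cod X g" h] by (simp add: mem_Hom_iff)

lemma cmp_zero' [simp]: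
  "f \<in> Arr X \<Longrightarrow> Cod X f = B \<Longrightarrow> C \<in> Obj X \<Longrightarrow> f \<cdot> \<zero> B C = \<zero> (Dom X f) C"
  using cmp_zero[of f "Dom X f" "Cod X f" C] by (simp add: mem_Hom_iff)

text \<open>
  Composites are normalized by bracketing to the right, so each rule that moves an arrow into a
  sum or a pairing needs a companion for the case that the composite continues.
\<close>

lemma cmp_plus_cmp [simp]:
  assumes "f \<in> Arr X" "g \<in> Arr X" "h \<in> Arr X" "k \<in> Arr X" "Cod X f = Dom X g"
    "Dom X g = Dom X h" "Cod X g = Cod X h" "Cod X h = Dom X k"
  shows "f \<cdot> ((g \<boxplus> h) \<cdot> k) = (f \<cdot> g \<boxplus> f \<cdot> h) \<cdot> k"
  using assms cmp_assoc'[of f "g \<boxplus> h" k] by simp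

lemma additive_cmp_plus:
  assumes "additive_arr X k" "f \<in> Arr X" "g \<in> Arr X" "Dom X f = Dom X g"
    and "Cod X f = Dom X k" "Cod X g = Dom X k"
  shows "(f \<boxplus> g) \<cdot> k = f \<cdot> k \<boxplus> g \<cdot> k"
proof -
  have "f \<in> Hom (Dom X g) (Dom X k)" "g \<in> Hom (Dom X g) (Dom X k)"
    using assms by (simp_all add: mem_Hom_iff)
  then show ?thesis
    using assms(1,3) Dom_in_Obj unfolding additive_arr_def by blast
qed

end

context cartesian_left_additive_category
begin

lemma prod_Obj [simp]: "A \<in> Obj X \<Longrightarrow> B \<in> Obj X \<Longrightarrow> A \<otimes> B \<in> Obj X"
  by (fact prod_in_Obj)

lemma Terminal_Obj [simp]: "\<top> \<in> Obj X"
  by (fact Terminal_in_Obj)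

lemma proj_typing [simp]:
  assumes "A \<in> Obj X" "B \<in> Obj X"
  shows "\<pi>\<^sub>0 A B \<in> Arr X" "Dom X (\<pi>\<^sub>0 A B) = A \<otimes> B" "Cod X (\<pi>\<^sub>0 A B) = A"
    "\<pi>\<^sub>1 A B \<in> Arr X" "Dom X (\<pi>\<^sub>1 A B) = A \<otimes> B" "Cod X (\<pi>\<^sub>1 A B) = B"
  using proj0_in_Hom[OF assms] proj1_in_Hom[OF assms] by (simp_all add: mem_Hom_iff)

lemma pairing_typing [simp]:
  assumes "f \<in> Arr X" "g \<in> Arr X" "Dom X f = Dom X g"
  shows "\<langle>f, g\<rangle> \<in> Arr X" "Dom X \<langle>f, g\<rangle> = Dom X g" "Cod X \<langle>f, g\<rangle> = Cod X f \<otimes> Cod X g"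
  using pairing_in_Hom[of f "Dom X f" "Cod X f" g "Cod X g"] assms by (simp_all add: mem_Hom_iff)

lemma pairing_proj [simp]:
  assumes "f \<in> Arr X" "g \<in> Arr X" "Dom X f = Dom X g" "Cod X f = A" "Cod X g = B"
  shows "\<langle>f, g\<rangle> \<cdot> \<pi>\<^sub>0 A B = f" "\<langle>f, g\<rangle> \<cdot> \<pi>\<^sub>1 A B = g"
  using pairing_proj0[of f "Dom X f" A g B] pairing_proj1[of f "Dom X f" A g B] assms
  by (simp_all add: mem_Hom_iff)

lemma pairing_proj_cmp [simp]:
  assumes "f \<in> Arr X" "g \<in> Arr X" "Dom X f = Dom X g" "Cod X f = A" "Cod X g = B" "k \<in> Arr X"
  shows "Dom X k = A \<Longrightarrow> \<langle>f, g\<rangle> \<cdot> (\<pi>\<^sub>0 A B \<cdot> k) = f \<cdot> k"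
    and "Dom X k = B \<Longrightarrow> \<langle>f, g\<rangle> \<cdot> (\<pi>\<^sub>1 A B \<cdot> k) = g \<cdot> k"
  using assms cmp_assoc'[of "\<langle>f, g\<rangle>" "\<pi>\<^sub>0 A B" k] cmp_assoc'[of "\<langle>f, g\<rangle>" "\<pi>\<^sub>1 A B" k] by auto

text \<open>
  The uniqueness part of the universal property: two arrows into a product that agree after both
  projections are equal.  The laws for composing and adding pairings follow from it.
\<close>

lemma pairing_eta:
  "A \<in> Obj X \<Longrightarrow> B \<in> Obj X \<Longrightarrow> h \<in> Arr X \<Longrightarrow> Cod X h = A \<otimes> B \<Longrightarrow>
    \<langle>h \<cdot> \<pi>\<^sub>0 A B, h \<cdot> \<pi>\<^sub>1 A B\<rangle> = h"
  using pairing_unique[of A B h "Dom X h"] by (simp add: mem_Hom_iff)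

lemma pairing_proj_ident [simp]:
  "A \<in> Obj X \<Longrightarrow> B \<in> Obj X \<Longrightarrow> \<langle>\<pi>\<^sub>0 A B, \<pi>\<^sub>1 A B\<rangle> = \<one> (A \<otimes> B)"
  using pairing_eta[of A B "\<one> (A \<otimes> B)"] by simp

lemma cmp_pairing [simp]:
  assumes "k \<in> Arr X" "f \<in> Arr X" "g \<in> Arr X" "Dom X f = Dom X g" "Cod X k = Dom X g"
  shows "k \<cdot> \<langle>f, g\<rangle> = \<langle>k \<cdot> f, k \<cdot> g\<rangle>"
  using assms pairing_eta[of "Cod X f" "Cod X g" "k \<cdot> \<langle>f, g\<rangle>"] by simp

lemma cmp_pairing_cmp [simp]:
  assumes "k \<in> Arr X" "f \<in> Arr X" "g \<in> Arr X" "Dom X f = Dom X g" "Cod X k = Dom X g"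
    "h \<in> Arr X" "Dom X h = Cod X f \<otimes> Cod X g"
  shows "k \<cdot> (\<langle>f, g\<rangle> \<cdot> h) = \<langle>k \<cdot> f, k \<cdot> g\<rangle> \<cdot> h"
  using assms cmp_assoc'[of k "\<langle>f, g\<rangle>" h] by simp

lemma plus_cmp_proj [simp]:
  assumes "A \<in> Obj X" "B \<in> Obj X" "f \<in> Arr X" "g \<in> Arr X" "Dom X f = Dom X g"
    "Cod X f = A \<otimes> B" "Cod X g = A \<otimes> B"
  shows "(f \<boxplus> g) \<cdot> \<pi>\<^sub>0 A B = f \<cdot> \<pi>\<^sub>0 A B \<boxplus> g \<cdot> \<pi>\<^sub>0 A B"
    and "(f \<boxplus> g) \<cdot> \<pi>\<^sub>1 A B = f \<cdot> \<pi>\<^sub>1 A B \<boxplus> g \<cdot> \<pi>\<^sub>1 A B"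
  using additive_cmp_plus[OF proj0_additive] additive_cmp_plus[OF proj1_additive] assms
  by simp_all

lemma zero_cmp_proj [simp]:
  assumes "A \<in> Obj X" "B \<in> Obj X" "C \<in> Obj X"
  shows "\<zero> C (A \<otimes> B) \<cdot> \<pi>\<^sub>0 A B = \<zero> C A" "\<zero> C (A \<otimes> B) \<cdot> \<pi>\<^sub>1 A B = \<zero> C B"
  using proj0_additive[of A B] proj1_additive[of A B] assms
  by (auto simp: additive_arr_def mem_Hom_iff)

lemma pairing_plus [simp]:
  assumes "f \<in> Arr X" "g \<in> Arr X" "Dom X f = Dom X g"
    and "f' \<in> Arr X" "g' \<in> Arr X" "Dom X f' = Dom X g'"
    and "Dom X g = Dom X g'" "Cod X f = Cod X f'" "Cod X g = Cod X g'"
  shows "\<langle>f, g\<rangle> \<boxplus> \<langle>f', g'\<rangle> = \<langle>f \<boxplus> f', g \<boxplus> g'\<rangle>"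
  using assms pairing_eta[of "Cod X f" "Cod X g" "\<langle>f, g\<rangle> \<boxplus> \<langle>f', g'\<rangle>"] by simp

lemmas arrow_defs = prod_arr_def sum_arr_def mem_Hom_iff

lemma inverse_alpha:
  assumes "C \<in> Obj X" "A \<in> Obj X" "B \<in> Obj X"
  shows "inverse_arr X (\<alpha> C A B) =
    \<langle>\<pi>\<^sub>0 (C \<otimes> A) B \<cdot> \<pi>\<^sub>0 C A, \<langle>\<pi>\<^sub>0 (C \<otimes> A) B \<cdot> \<pi>\<^sub>1 C A, \<pi>\<^sub>1 (C \<otimes> A) B\<rangle>\<rangle>"
  using assms pairing_eta[of C A "\<pi>\<^sub>0 (C \<otimes> A) B"] pairing_eta[of A B "\<pi>\<^sub>1 C (A \<otimes> B)"]
  by (intro inverse_arr_eqI[of _ "C \<otimes> (A \<otimes> B)" "(C \<otimes> A) \<otimes> B"])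
    (simp_all add: arrow_defs alpha_arr_def)

lemma inverse_beta:
  assumes "C \<in> Obj X" "A \<in> Obj X" "B \<in> Obj X"
  shows "inverse_arr X (\<beta> C A B) =
    \<langle>\<pi>\<^sub>0 (C \<otimes> B) A \<cdot> \<pi>\<^sub>0 C B, \<langle>\<pi>\<^sub>1 (C \<otimes> B) A, \<pi>\<^sub>0 (C \<otimes> B) A \<cdot> \<pi>\<^sub>1 C B\<rangle>\<rangle>"
  using assms pairing_eta[of C B "\<pi>\<^sub>0 (C \<otimes> B) A"] pairing_eta[of A B "\<pi>\<^sub>1 C (A \<otimes> B)"]
  by (intro inverse_arr_eqI[of _ "C \<otimes> (A \<otimes> B)" "(C \<otimes> B) \<otimes> A"])
    (simp_all add: arrow_defs beta_arr_def)

end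

section \<open>Calculus of linearizing combinators\<close>

context system_of_linearizing_combinators
begin

lemma L_typing [simp]:
  assumes "C \<in> Obj X" "A \<in> Obj X" "f \<in> Arr X" "Dom X f = C \<otimes> A"
  shows "L C A f \<in> Arr X" "Dom X (L C A f) = C \<otimes> A" "Cod X (L C A f) = Cod X f"
  using L_in_Hom[of C A f "Cod X f"] assms by (simp_all add: mem_Hom_iff)

lemma L_plus [simp]:
  "C \<in> Obj X \<Longrightarrow> A \<in> Obj X \<Longrightarrow> f \<in> Arr X \<Longrightarrow> g \<in> Arr X \<Longrightarrow> Dom X f = C \<otimes> A \<Longrightarrow>
    Dom X g = C \<otimes> A \<Longrightarrow> Cod X f = Cod X g \<Longrightarrow> L C A (f \<boxplus> g) = L C A f \<boxplus> L C A g"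
  using L1_plus by (simp add: mem_Hom_iff)

lemma L_pairing [simp]:
  "C \<in> Obj X \<Longrightarrow> A \<in> Obj X \<Longrightarrow> f \<in> Arr X \<Longrightarrow> g \<in> Arr X \<Longrightarrow> Dom X f = C \<otimes> A \<Longrightarrow>
    Dom X g = C \<otimes> A \<Longrightarrow> L C A \<langle>f, g\<rangle> = \<langle>L C A f, L C A g\<rangle>"
  using L4[of C A f "Cod X f" g "Cod X g"] by (simp add: mem_Hom_iff)

lemma L_idem [simp]:
  "C \<in> Obj X \<Longrightarrow> A \<in> Obj X \<Longrightarrow> f \<in> Arr X \<Longrightarrow> Dom X f = C \<otimes> A \<Longrightarrow> L C A (L C A f) = L C A f"
  using L6[of C A f "Cod X f"] by (simp add: mem_Hom_iff)

declare L1_zero [simp] L3 [simp] L3_proj0 [simp] L3_proj1 [simp]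

text \<open>
  The laws of \<open>L\<close> are used in pointwise form: precomposing an equation with a tuple of arrows out
  of an arbitrary \<open>T\<close> substitutes terms for its variables.
\<close>

lemma L_additive:
  assumes "C \<in> Obj X" "A \<in> Obj X" "f \<in> Hom (C \<otimes> A) B"
    and "c \<in> Hom T C" "a \<in> Hom T A" "b \<in> Hom T A"
  shows "\<langle>c, a \<boxplus> b\<rangle> \<cdot> L C A f = \<langle>c, a\<rangle> \<cdot> L C A f \<boxplus> \<langle>c, b\<rangle> \<cdot> L C A f"
  using arg_cong[OF L2_plus[OF assms(1-3)], of "\<lambda>k. \<langle>c, \<langle>a, b\<rangle>\<rangle> \<cdot> k"] assms
  by (simp add: arrow_defs)

lemma L_at_zero:
  assumes "C \<in> Obj X" "A \<in> Obj X" "f \<in> Hom (C \<otimes> A) B" "c \<in> Hom T C"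
  shows "\<langle>c, \<zero> T A\<rangle> \<cdot> L C A f = \<zero> T B"
proof -
  have "T \<in> Obj X" "B \<in> Obj X"
    using assms by (auto simp: mem_Hom_iff)
  then show ?thesis
    using arg_cong[OF L2_zero[OF assms(1-3)], of "\<lambda>k. \<langle>c, \<zero> T A\<rangle> \<cdot> k"] assms
    by (simp add: arrow_defs)
qed

text \<open>
  Linearization commutes with substitution of the parameter:
  \<open>L\<^sup>C[y \<mapsto> f(c, y)]\<close> at \<open>c = h c'\<close> is \<open>L\<^sup>C'[y \<mapsto> f(h c', y)]\<close>.
\<close>

lemma L_reindex:
  assumes "C \<in> Obj X" "A \<in> Obj X" "f \<in> Hom (C \<otimes> A) B"
    and "h \<in> Hom C' C" "k \<in> Hom T C'" "a \<in> Hom T A"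
  shows "\<langle>k \<cdot> h, a\<rangle> \<cdot> L C A f = \<langle>k, a\<rangle> \<cdot> L C' A (\<langle>\<pi>\<^sub>0 C' A \<cdot> h, \<pi>\<^sub>1 C' A\<rangle> \<cdot> f)"
proof -
  have "C' \<in> Obj X"
    using assms by (auto simp: mem_Hom_iff)
  then show ?thesis
    using arg_cong[OF L8[OF assms(1,2,4,3)], of "\<lambda>g. \<langle>k, a\<rangle> \<cdot> g"] assms
    by (simp add: arrow_defs)
qed

text \<open>
  A function constant in its second argument factors through the zero map, so the chain rule
  evaluates its linearization at \<open>L[0] = 0\<close>, where every linearization vanishes.
\<close>

lemma L_constant [simp]:
  assumes "C \<in> Obj X" "A \<in> Obj X" "k \<in> Arr X" "Dom X k = C"
  shows "L C A (\<pi>\<^sub>0 C A \<cdot> k) = \<zero> (C \<otimes> A) (Cod X k)"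
proof -
  let ?Z = "\<zero> (C \<otimes> A) A"
  have "L C A (\<pi>\<^sub>0 C A \<cdot> k) = L C A (\<langle>\<pi>\<^sub>0 C A, ?Z\<rangle> \<cdot> (\<pi>\<^sub>0 C A \<cdot> k))"
    using assms by simp
  also have "\<dots> = \<langle>\<pi>\<^sub>0 C A, ?Z\<rangle> \<cdot>
      L C A (\<langle>\<pi>\<^sub>0 C A, \<pi>\<^sub>1 C A \<boxplus> \<langle>\<pi>\<^sub>0 C A, ?Z\<rangle> \<cdot> ?Z\<rangle> \<cdot> (\<pi>\<^sub>0 C A \<cdot> k))"
    using assms L5[of C A A ?Z "\<pi>\<^sub>0 C A \<cdot> k" "Cod X k"] by (simp add: mem_Hom_iff)
  also have "\<dots> = \<zero> (C \<otimes> A) (Cod X k)"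
    using assms by (intro L_at_zero) (simp_all add: mem_Hom_iff)
  finally show ?thesis .
qed

lemma L_proj0 [simp]: "C \<in> Obj X \<Longrightarrow> A \<in> Obj X \<Longrightarrow> L C A (\<pi>\<^sub>0 C A) = \<zero> (C \<otimes> A) C"
  using L_constant[of C A "\<one> C"] by simp

text \<open>
  In the chain rule for \<open>g(c, f(c, y))\<close> the second factor linearizes \<open>g(c, z + f(c, 0))\<close>.  A linear
  \<open>f\<close> vanishes at zero, so this translation disappears.
\<close>

lemma L_cmp_linear:
  assumes "C \<in> Obj X" "A \<in> Obj X" "B \<in> Obj X"
    and f: "f \<in> Hom (C \<otimes> A) B" "L C A f = f" and g: "g \<in> Hom (C \<otimes> B) E"
  shows "L C A (\<langle>\<pi>\<^sub>0 C A, f\<rangle> \<cdot> g) = \<langle>\<pi>\<^sub>0 C A, f\<rangle> \<cdot> L C B g"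
proof -
  have "\<langle>\<pi>\<^sub>0 C B, \<zero> (C \<otimes> B) A\<rangle> \<cdot> f = \<zero> (C \<otimes> B) B"
    using L_at_zero[of C A f B "\<pi>\<^sub>0 C B" "C \<otimes> B"] assms by (simp add: mem_Hom_iff)
  then show ?thesis
    using L5[OF assms(1-3) f(1) g] assms by (simp add: mem_Hom_iff)
qed

text \<open>
  The inclusion \<open>u \<mapsto> (u, 0)\<close> is linear, so restricting \<open>F\<close> along it commutes with linearization.
\<close>

lemma L_partial0:
  assumes "C \<in> Obj X" "A \<in> Obj X" "B \<in> Obj X" "F \<in> Hom (C \<otimes> (A \<otimes> B)) E"
    and "c \<in> Hom T C" "a \<in> Hom T A"
  shows "\<langle>c, \<langle>a, \<zero> T B\<rangle>\<rangle> \<cdot> L C (A \<otimes> B) F =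
    \<langle>c, a\<rangle> \<cdot> L C A (\<langle>\<pi>\<^sub>0 C A, \<langle>\<pi>\<^sub>1 C A, \<zero> (C \<otimes> A) B\<rangle>\<rangle> \<cdot> F)"
  using assms L_cmp_linear[of C A "A \<otimes> B" "\<langle>\<pi>\<^sub>1 C A, \<zero> (C \<otimes> A) B\<rangle>" F E]
  by (auto simp: mem_Hom_iff)

lemma L_partial1:
  assumes "C \<in> Obj X" "A \<in> Obj X" "B \<in> Obj X" "F \<in> Hom (C \<otimes> (A \<otimes> B)) E"
    and "c \<in> Hom T C" "b \<in> Hom T B"
  shows "\<langle>c, \<langle>\<zero> T A, b\<rangle>\<rangle> \<cdot> L C (A \<otimes> B) F =
    \<langle>c, b\<rangle> \<cdot> L C B (\<langle>\<pi>\<^sub>0 C B, \<langle>\<zero> (C \<otimes> B) A, \<pi>\<^sub>1 C B\<rangle>\<rangle> \<cdot> F)"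
  using assms L_cmp_linear[of C B "A \<otimes> B" "\<langle>\<zero> (C \<otimes> B) A, \<pi>\<^sub>1 C B\<rangle>" F E]
  by (auto simp: mem_Hom_iff)

section \<open>The differential combinator and its partial derivatives\<close>

abbreviation D :: "'m \<Rightarrow> 'm"
  where "D \<equiv> D_of_L X L"

lemma D_typing [simp]:
  assumes "f \<in> Arr X"
  shows "D f \<in> Arr X" "Dom X (D f) = Dom X f \<otimes> Dom X f" "Cod X (D f) = Cod X f"
  using assms by (simp_all add: D_of_L_def sum_arr_def)

lemma D_eq_L: "f \<in> Hom A B \<Longrightarrow> D f = L A A ((\<pi>\<^sub>0 A A \<boxplus> \<pi>\<^sub>1 A A) \<cdot> f)"
  by (simp add: D_of_L_def arrow_defs)

lemma L_D: "f \<in> Hom A B \<Longrightarrow> L A A (D f) = D f"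
  by (auto simp: D_of_L_def arrow_defs)

lemma D_additive:
  assumes "f \<in> Hom A B" "p \<in> Hom T A" "a \<in> Hom T A" "b \<in> Hom T A"
  shows "\<langle>p, a \<boxplus> b\<rangle> \<cdot> D f = \<langle>p, a\<rangle> \<cdot> D f \<boxplus> \<langle>p, b\<rangle> \<cdot> D f"
  unfolding D_eq_L[OF assms(1)] using assms
  by (intro L_additive[where B = B and T = T]) (auto simp: mem_Hom_iff)

lemma D_at_zero:
  assumes "f \<in> Hom A B" "p \<in> Hom T A"
  shows "\<langle>p, \<zero> T A\<rangle> \<cdot> D f = \<zero> T B"
  unfolding D_eq_L[OF assms(1)] using assms
  by (intro L_at_zero) (auto simp: mem_Hom_iff)

text \<open>
  The partial derivatives of a function of two variables:
  \<open>D f ((c, x), (u, 0)) = L[w \<mapsto> f(c + w, x)](u)\<close>, and symmetrically for the second variable.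
\<close>

lemma D_partial0:
  assumes "C \<in> Obj X" "A \<in> Obj X" "f \<in> Hom (C \<otimes> A) B"
    and "c \<in> Hom T C" "x \<in> Hom T A" "u \<in> Hom T C"
  shows "\<langle>\<langle>c, x\<rangle>, \<langle>u, \<zero> T A\<rangle>\<rangle> \<cdot> D f = \<langle>\<langle>c, x\<rangle>, u\<rangle> \<cdot>
    L (C \<otimes> A) C (\<langle>\<pi>\<^sub>0 (C \<otimes> A) C \<cdot> \<pi>\<^sub>0 C A \<boxplus> \<pi>\<^sub>1 (C \<otimes> A) C, \<pi>\<^sub>0 (C \<otimes> A) C \<cdot> \<pi>\<^sub>1 C A\<rangle> \<cdot> f)"
proof -
  let ?P = "C \<otimes> A"
  have "\<langle>\<langle>c, x\<rangle>, \<langle>u, \<zero> T A\<rangle>\<rangle> \<cdot> D f = \<langle>\<langle>c, x\<rangle>, u\<rangle> \<cdot>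
    L ?P C (\<langle>\<pi>\<^sub>0 ?P C, \<langle>\<pi>\<^sub>1 ?P C, \<zero> (?P \<otimes> C) A\<rangle>\<rangle> \<cdot> ((\<pi>\<^sub>0 ?P ?P \<boxplus> \<pi>\<^sub>1 ?P ?P) \<cdot> f))"
    unfolding D_eq_L[OF assms(3)] using assms
    by (intro L_partial0[where E = B]) (auto simp: mem_Hom_iff)
  moreover have "\<pi>\<^sub>0 ?P C \<boxplus> \<langle>\<pi>\<^sub>1 ?P C, \<zero> (?P \<otimes> C) A\<rangle> =
      \<langle>\<pi>\<^sub>0 ?P C \<cdot> \<pi>\<^sub>0 C A \<boxplus> \<pi>\<^sub>1 ?P C, \<pi>\<^sub>0 ?P C \<cdot> \<pi>\<^sub>1 C A\<rangle>"
    using assms pairing_eta[of C A "\<pi>\<^sub>0 ?P C \<boxplus> \<langle>\<pi>\<^sub>1 ?P C, \<zero> (?P \<otimes> C) A\<rangle>"] by simp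
  ultimately show ?thesis
    using assms by (simp add: mem_Hom_iff)
qed

lemma D_partial1:
  assumes "C \<in> Obj X" "A \<in> Obj X" "f \<in> Hom (C \<otimes> A) B"
    and "c \<in> Hom T C" "x \<in> Hom T A" "a \<in> Hom T A"
  shows "\<langle>\<langle>c, x\<rangle>, \<langle>\<zero> T C, a\<rangle>\<rangle> \<cdot> D f = \<langle>\<langle>c, x\<rangle>, a\<rangle> \<cdot>
    L (C \<otimes> A) A (\<langle>\<pi>\<^sub>0 (C \<otimes> A) A \<cdot> \<pi>\<^sub>0 C A, \<pi>\<^sub>0 (C \<otimes> A) A \<cdot> \<pi>\<^sub>1 C A \<boxplus> \<pi>\<^sub>1 (C \<otimes> A) A\<rangle> \<cdot> f)"
proof -
  let ?P = "C \<otimes> A"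
  have "\<langle>\<langle>c, x\<rangle>, \<langle>\<zero> T C, a\<rangle>\<rangle> \<cdot> D f = \<langle>\<langle>c, x\<rangle>, a\<rangle> \<cdot>
    L ?P A (\<langle>\<pi>\<^sub>0 ?P A, \<langle>\<zero> (?P \<otimes> A) C, \<pi>\<^sub>1 ?P A\<rangle>\<rangle> \<cdot> ((\<pi>\<^sub>0 ?P ?P \<boxplus> \<pi>\<^sub>1 ?P ?P) \<cdot> f))"
    unfolding D_eq_L[OF assms(3)] using assms
    by (intro L_partial1[where E = B]) (auto simp: mem_Hom_iff)
  moreover have "\<pi>\<^sub>0 ?P A \<boxplus> \<langle>\<zero> (?P \<otimes> A) C, \<pi>\<^sub>1 ?P A\<rangle> =
      \<langle>\<pi>\<^sub>0 ?P A \<cdot> \<pi>\<^sub>0 C A, \<pi>\<^sub>0 ?P A \<cdot> \<pi>\<^sub>1 C A \<boxplus> \<pi>\<^sub>1 ?P A\<rangle>"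
    using assms pairing_eta[of C A "\<pi>\<^sub>0 ?P A \<boxplus> \<langle>\<zero> (?P \<otimes> A) C, \<pi>\<^sub>1 ?P A\<rangle>"] by simp
  ultimately show ?thesis
    using assms by (simp add: mem_Hom_iff)
qed

text \<open>
  At \<open>x = 0\<close> the translation by \<open>x\<close> is trivial, so the partial derivative at zero recovers \<open>L\<^sup>C\<close>.
\<close>

lemma D_partial1_at_zero:
  assumes "C \<in> Obj X" "A \<in> Obj X" "f \<in> Hom (C \<otimes> A) B" "c \<in> Hom T C" "a \<in> Hom T A"
  shows "\<langle>\<langle>c, \<zero> T A\<rangle>, \<langle>\<zero> T C, a\<rangle>\<rangle> \<cdot> D f = \<langle>c, a\<rangle> \<cdot> L C A f"
proof -
  let ?P = "C \<otimes> A"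
  let ?G = "\<langle>\<pi>\<^sub>0 ?P A \<cdot> \<pi>\<^sub>0 C A, \<pi>\<^sub>0 ?P A \<cdot> \<pi>\<^sub>1 C A \<boxplus> \<pi>\<^sub>1 ?P A\<rangle> \<cdot> f"
  have T: "T \<in> Obj X"
    using assms by (auto simp: mem_Hom_iff)
  have "\<langle>\<langle>c, \<zero> T A\<rangle>, \<langle>\<zero> T C, a\<rangle>\<rangle> \<cdot> D f = \<langle>\<langle>c, \<zero> T A\<rangle>, a\<rangle> \<cdot> L ?P A ?G"
    using assms T by (intro D_partial1) (auto simp: mem_Hom_iff)
  also have "\<dots> = \<langle>c \<cdot> \<langle>\<one> C, \<zero> C A\<rangle>, a\<rangle> \<cdot> L ?P A ?G"
    using assms T by (simp add: mem_Hom_iff)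
  also have "\<dots> =
      \<langle>c, a\<rangle> \<cdot> L C A (\<langle>\<pi>\<^sub>0 C A \<cdot> \<langle>\<one> C, \<zero> C A\<rangle>, \<pi>\<^sub>1 C A\<rangle> \<cdot> ?G)"
    using assms by (intro L_reindex[where B = B]) (auto simp: mem_Hom_iff)
  also have "\<dots> = \<langle>c, a\<rangle> \<cdot> L C A f"
    using assms by (simp add: mem_Hom_iff)
  finally show ?thesis .
qed

text \<open>
  A linear map is additive, so a translate of it differs from it by a constant, and the
  linearization of the translate is the map itself.
\<close>

lemma D_partial1_linear:
  assumes "C \<in> Obj X" "A \<in> Obj X" and f: "f \<in> Hom (C \<otimes> A) B" and lin: "L C A f = f"
    and "c \<in> Hom T C" "x \<in> Hom T A" "a \<in> Hom T A"
  shows "\<langle>\<langle>c, x\<rangle>, \<langle>\<zero> T C, a\<rangle>\<rangle> \<cdot> D f = \<langle>c, a\<rangle> \<cdot> f"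
proof -
  let ?P = "C \<otimes> A"
  \<comment> \<open>The generic \<open>c\<close>, \<open>x\<close> and \<open>a\<close>, with \<open>c\<close> and \<open>x\<close> together as parameter.\<close>
  let ?c = "\<pi>\<^sub>0 ?P A \<cdot> \<pi>\<^sub>0 C A" and ?x = "\<pi>\<^sub>0 ?P A \<cdot> \<pi>\<^sub>1 C A" and ?a = "\<pi>\<^sub>1 ?P A"
  have split: "\<langle>?c, ?x \<boxplus> ?a\<rangle> \<cdot> f = \<langle>?c, ?x\<rangle> \<cdot> f \<boxplus> \<langle>?c, ?a\<rangle> \<cdot> f"
    using assms L_additive[of C A f B ?c "?P \<otimes> A" ?x ?a] by (simp add: mem_Hom_iff)
  have const: "\<langle>?c, ?x\<rangle> \<cdot> f = \<pi>\<^sub>0 ?P A \<cdot> f"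
    using assms pairing_eta[of C A "\<pi>\<^sub>0 ?P A"] by simp
  have var: "L ?P A (\<langle>?c, ?a\<rangle> \<cdot> f) = \<langle>?c, ?a\<rangle> \<cdot> f"
    using assms L8[of C A "\<pi>\<^sub>0 C A" ?P f B] by (simp add: arrow_defs)
  have "L ?P A (\<langle>?c, ?x \<boxplus> ?a\<rangle> \<cdot> f) = \<langle>?c, ?a\<rangle> \<cdot> f"
    unfolding split const using assms by (auto simp: mem_Hom_iff var)
  then show ?thesis
    using D_partial1[OF assms(1-3,5-7)] assms by (simp add: mem_Hom_iff)
qed

text \<open>
  Linearity with respect to \<open>D\<close> says \<open>D f ((c, x), (0, a)) = f(c, a)\<close> for all \<open>c\<close>, \<open>x\<close>, \<open>a\<close>.
  Its instance \<open>x = 0\<close> is \<open>L\<^sup>C[f] = f\<close>, and \<open>D_partial1_linear\<close> recovers the general equation.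
\<close>

lemma linear_in_second_iff:
  assumes "C \<in> Obj X" "A \<in> Obj X" and f: "f \<in> Hom (C \<otimes> A) B"
  shows "linear_in_second X D C A f \<longleftrightarrow> L C A f = f"
proof -
  let ?Q = "C \<otimes> (A \<otimes> A)"
  let ?c = "\<pi>\<^sub>0 C (A \<otimes> A)"
    and ?x = "\<pi>\<^sub>1 C (A \<otimes> A) \<cdot> \<pi>\<^sub>0 A A" and ?a = "\<pi>\<^sub>1 C (A \<otimes> A) \<cdot> \<pi>\<^sub>1 A A"
  have unfold: "linear_in_second X D C A f \<longleftrightarrow>
      \<langle>\<langle>?c, ?x\<rangle>, \<langle>\<zero> ?Q C, ?a\<rangle>\<rangle> \<cdot> D f = \<langle>?c, ?a\<rangle> \<cdot> f"
    using assms by (simp add: linear_in_second_def partial_D_def arrow_defs)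
  show ?thesis
  proof
    assume "linear_in_second X D C A f"
    then have eq: "\<langle>\<langle>?c, ?x\<rangle>, \<langle>\<zero> ?Q C, ?a\<rangle>\<rangle> \<cdot> D f = \<langle>?c, ?a\<rangle> \<cdot> f"
      by (simp only: unfold)
    \<comment> \<open>Substituting \<open>(c, (0, a))\<close> for \<open>(c, (x, a))\<close>.\<close>
    let ?e = "\<langle>\<pi>\<^sub>0 C A, \<langle>\<zero> (C \<otimes> A) A, \<pi>\<^sub>1 C A\<rangle>\<rangle>"
    have "\<langle>\<langle>\<pi>\<^sub>0 C A, \<zero> (C \<otimes> A) A\<rangle>, \<langle>\<zero> (C \<otimes> A) C, \<pi>\<^sub>1 C A\<rangle>\<rangle> \<cdot> D f = f"
      using arg_cong[OF eq, of "\<lambda>k. ?e \<cdot> k"] assms by (simp add: mem_Hom_iff)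
    then show "L C A f = f"
      using D_partial1_at_zero[OF assms, of "\<pi>\<^sub>0 C A" "C \<otimes> A" "\<pi>\<^sub>1 C A"] assms
      by (simp add: mem_Hom_iff)
  next
    assume "L C A f = f"
    then show "linear_in_second X D C A f"
      unfolding unfold using assms
      by (intro D_partial1_linear) (auto simp: mem_Hom_iff)
  qed
qed

section \<open>Symmetry of the second derivative\<close>

text \<open>
  Here \<open>H ((x, u), v) = L[w \<mapsto> D f (x + w, u)](v)\<close> is an iterated linearization of
  \<open>F (x, (u, v)) = f(x + u + v)\<close>, with increment \<open>u\<close> for the inner linearization and \<open>v\<close> for the
  outer one.  Linearizing \<open>F\<close> first in its middle and then in its last argument gives
  \<open>H ((x, u), v)\<close>; the opposite order gives \<open>H ((x, v), u)\<close>, and the two orders agree.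
\<close>

lemma mixed_partials_commute:
  fixes A :: 'o and f :: 'm
  defines "H \<equiv> L (A \<otimes> A) A
    (\<langle>\<pi>\<^sub>0 (A \<otimes> A) A \<cdot> \<pi>\<^sub>0 A A \<boxplus> \<pi>\<^sub>1 (A \<otimes> A) A, \<pi>\<^sub>0 (A \<otimes> A) A \<cdot> \<pi>\<^sub>1 A A\<rangle> \<cdot> D f)"
  assumes A [simp]: "A \<in> Obj X" and f: "f \<in> Hom A B"
    and x: "x \<in> Hom T A" and u: "u \<in> Hom T A" and v: "v \<in> Hom T A"
  shows "\<langle>\<langle>x, u\<rangle>, v\<rangle> \<cdot> H = \<langle>\<langle>x, v\<rangle>, u\<rangle> \<cdot> H"
proof -
  let ?P = "A \<otimes> A"
  let ?x = "\<pi>\<^sub>0 A ?P" and ?u = "\<pi>\<^sub>1 A ?P \<cdot> \<pi>\<^sub>0 A A" and ?v = "\<pi>\<^sub>1 A ?P \<cdot> \<pi>\<^sub>1 A A"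
  let ?F = "(?x \<boxplus> (?u \<boxplus> ?v)) \<cdot> f"
  let ?x' = "\<pi>\<^sub>0 ?P A \<cdot> \<pi>\<^sub>0 A A" and ?u' = "\<pi>\<^sub>0 ?P A \<cdot> \<pi>\<^sub>1 A A" and ?v' = "\<pi>\<^sub>1 ?P A"
  let ?G = "((?x' \<boxplus> ?u') \<boxplus> ?v') \<cdot> f"
  note [simp] = f[unfolded mem_Hom_iff]
  \<comment> \<open>After the reshuffling by \<open>\<alpha>\<close> or \<open>\<beta>\<close>, both linearizations of \<open>F\<close> act on the same
    \<open>?G\<close>, which is \<open>\<oplus> A \<cdot> f\<close> reparametrized along \<open>\<oplus> A\<close>.\<close>
  have sum_f: "L ?P A ?G = \<langle>?x' \<boxplus> ?u', ?v'\<rangle> \<cdot> D f"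
    using L8[of A A "\<oplus> A" ?P "\<oplus> A \<cdot> f" B] by (simp add: arrow_defs D_eq_L[OF f])
  have comm: "?x' \<boxplus> (?v' \<boxplus> ?u') = (?x' \<boxplus> ?u') \<boxplus> ?v'" "?x' \<boxplus> (?u' \<boxplus> ?v') = (?x' \<boxplus> ?u') \<boxplus> ?v'"
    by (simp_all add: plus_ac)
  have first: "L_first X L A A A ?F = \<langle>?x \<boxplus> ?v, ?u\<rangle> \<cdot> D f"
    by (simp add: L_first_def inverse_beta comm sum_f, simp add: beta_arr_def arrow_defs)
  have second: "L_second X L A A A ?F = \<langle>?x \<boxplus> ?u, ?v\<rangle> \<cdot> D f"
    by (simp add: L_second_def inverse_alpha comm sum_f, simp add: alpha_arr_def arrow_defs)
  have "L_second X L A A A (L_first X L A A A ?F) = \<langle>\<langle>?x, ?u\<rangle>, ?v\<rangle> \<cdot> H"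
    unfolding first H_def
    by (simp add: L_second_def inverse_alpha, simp add: alpha_arr_def arrow_defs)
  moreover have "L_first X L A A A (L_second X L A A A ?F) = \<langle>\<langle>?x, ?v\<rangle>, ?u\<rangle> \<cdot> H"
    unfolding second H_def
    by (simp add: L_first_def inverse_beta, simp add: beta_arr_def arrow_defs)
  moreover have "L_second X L A A A (L_first X L A A A ?F) = L_first X L A A A (L_second X L A A A ?F)"
    by (rule L7[of A A A ?F B]) (simp_all add: mem_Hom_iff)
  ultimately have "\<langle>\<langle>?x, ?u\<rangle>, ?v\<rangle> \<cdot> H = \<langle>\<langle>?x, ?v\<rangle>, ?u\<rangle> \<cdot> H"
    by simp
  from arg_cong[OF this, of "\<lambda>k. \<langle>x, \<langle>u, v\<rangle>\<rangle> \<cdot> k"] show ?thesis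
    using x u v by (simp add: mem_Hom_iff H_def)
qed

text \<open>
  The second derivative is additive in \<open>(y, a) = (y, 0) + (0, a)\<close>; the term with \<open>(0, a)\<close> loses its
  dependence on \<open>b\<close> because \<open>D f\<close> is linear in its second argument.
\<close>

lemma D_D_sum:
  assumes f: "f \<in> Hom A B"
    and "x \<in> Hom T A" "b \<in> Hom T A" "y \<in> Hom T A" "a \<in> Hom T A"
  shows "\<langle>\<langle>x, b\<rangle>, \<langle>y, a\<rangle>\<rangle> \<cdot> D (D f) =
    \<langle>\<langle>x, b\<rangle>, \<langle>y, \<zero> T A\<rangle>\<rangle> \<cdot> D (D f) \<boxplus> \<langle>x, a\<rangle> \<cdot> D f"
proof -
  have [simp]: "A \<in> Obj X" "B \<in> Obj X" "T \<in> Obj X"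
    using assms by (auto simp: mem_Hom_iff)
  have Df: "D f \<in> Hom (A \<otimes> A) B"
    using f by (auto simp: mem_Hom_iff)
  have "\<langle>\<langle>x, b\<rangle>, \<langle>y, \<zero> T A\<rangle> \<boxplus> \<langle>\<zero> T A, a\<rangle>\<rangle> \<cdot> D (D f) =
      \<langle>\<langle>x, b\<rangle>, \<langle>y, \<zero> T A\<rangle>\<rangle> \<cdot> D (D f) \<boxplus> \<langle>\<langle>x, b\<rangle>, \<langle>\<zero> T A, a\<rangle>\<rangle> \<cdot> D (D f)"
    using assms by (intro D_additive[OF Df, of _ T]) (simp_all add: mem_Hom_iff)
  moreover have "\<langle>\<langle>x, b\<rangle>, \<langle>\<zero> T A, a\<rangle>\<rangle> \<cdot> D (D f) = \<langle>x, a\<rangle> \<cdot> D f"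
    using assms by (intro D_partial1_linear[OF _ _ Df L_D[OF f]]) simp_all
  ultimately show ?thesis
    using assms by (simp add: mem_Hom_iff)
qed

lemma D_D_symmetric:
  assumes f: "f \<in> Hom A B"
    and "x \<in> Hom T A" "b \<in> Hom T A" "y \<in> Hom T A" "a \<in> Hom T A"
  shows "\<langle>\<langle>x, b\<rangle>, \<langle>y, a\<rangle>\<rangle> \<cdot> D (D f) = \<langle>\<langle>x, y\<rangle>, \<langle>b, a\<rangle>\<rangle> \<cdot> D (D f)"
proof -
  have A: "A \<in> Obj X" and Df: "D f \<in> Hom (A \<otimes> A) B"
    using f by (auto simp: mem_Hom_iff)
  have "\<langle>\<langle>x, b\<rangle>, \<langle>y, \<zero> T A\<rangle>\<rangle> \<cdot> D (D f) = \<langle>\<langle>x, y\<rangle>, \<langle>b, \<zero> T A\<rangle>\<rangle> \<cdot> D (D f)"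
    using D_partial0[OF A A Df, of x T b y] D_partial0[OF A A Df, of x T y b]
      mixed_partials_commute[OF A f, of x T b y] assms by simp
  then show ?thesis
    using D_D_sum[OF f, of x T b y a] D_D_sum[OF f, of x T y b a] assms by simp
qed

section \<open>The axioms of a Cartesian differential category\<close>

text \<open>
  With \<open>x\<close> as parameter, \<open>g(f(x + y))\<close> is a composite of two maps to which the chain rule of \<open>L\<close>
  applies; the translation by the value at \<open>y = 0\<close> is the translation by \<open>f x\<close> that defines \<open>D g\<close>.
\<close>

lemma D_cmp:
  assumes f: "f \<in> Hom A B" and g: "g \<in> Hom B E"
  shows "D (f \<cdot> g) = \<langle>\<pi>\<^sub>0 A A \<cdot> f, D f\<rangle> \<cdot> D g"
proof -
  have [simp]: "A \<in> Obj X" "B \<in> Obj X" "f \<in> Arr X" "Dom X f = A" "Cod X f = B"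
    "g \<in> Arr X" "Dom X g = B" "Cod X g = E"
    using f g by (auto simp: mem_Hom_iff)
  let ?s = "\<pi>\<^sub>0 A A \<boxplus> \<pi>\<^sub>1 A A"
  have "D (f \<cdot> g) = L A A (\<langle>\<pi>\<^sub>0 A A, ?s \<cdot> f\<rangle> \<cdot> (\<pi>\<^sub>1 A B \<cdot> g))"
    by (subst D_eq_L[of _ A E]) (simp_all add: mem_Hom_iff)
  also have "\<dots> = \<langle>\<pi>\<^sub>0 A A, D f\<rangle> \<cdot>
      L A B (\<langle>\<pi>\<^sub>0 A B, \<pi>\<^sub>1 A B \<boxplus> \<langle>\<pi>\<^sub>0 A B, \<zero> (A \<otimes> B) A\<rangle> \<cdot> (?s \<cdot> f)\<rangle> \<cdot> (\<pi>\<^sub>1 A B \<cdot> g))"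
    unfolding D_eq_L[OF f] by (intro L5) (simp_all add: mem_Hom_iff)
  \<comment> \<open>Both arguments of \<open>L A B\<close> are \<open>g(z + f x)\<close>; the second exhibits the parameter as \<open>f x\<close>.\<close>
  also have "\<dots> = \<langle>\<pi>\<^sub>0 A A, D f\<rangle> \<cdot>
      L A B (\<langle>\<pi>\<^sub>0 A B \<cdot> f, \<pi>\<^sub>1 A B\<rangle> \<cdot> ((\<pi>\<^sub>0 B B \<boxplus> \<pi>\<^sub>1 B B) \<cdot> g))"
    using plus_commute'[of "\<pi>\<^sub>1 A B" "\<pi>\<^sub>0 A B \<cdot> f"] by simp
  also have "\<dots> = \<langle>\<pi>\<^sub>0 A A \<cdot> f, D f\<rangle> \<cdot> D g"
    unfolding D_eq_L[OF g]
    by (intro L_reindex[symmetric, where B = E and T = "A \<otimes> A"]) (simp_all add: mem_Hom_iff)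
  finally show ?thesis .
qed

lemma cartesian_differential_category_D: "cartesian_differential_category X D"
proof
  fix f A B assume "f \<in> Hom A B"
  then show "D f \<in> Hom (A \<otimes> A) B"
    by (simp add: mem_Hom_iff)
next
  fix f g A B assume "f \<in> Hom A B" "g \<in> Hom A B"
  then show "D (f \<boxplus> g) = D f \<boxplus> D g"
    by (auto simp: D_of_L_def arrow_defs)
next
  fix A B assume "A \<in> Obj X" "B \<in> Obj X"
  then show "D (\<zero> A B) = \<zero> (A \<otimes> A) B"
    by (simp add: D_of_L_def arrow_defs)
next
  fix f A B assume f: "f \<in> Hom A B"
  then show "(\<one> A \<boxtimes> \<oplus> A) \<cdot> D f = (\<one> A \<boxtimes> \<pi>\<^sub>0 A A) \<cdot> D f \<boxplus> (\<one> A \<boxtimes> \<pi>\<^sub>1 A A) \<cdot> D f"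
    using L2_plus[of A A "\<oplus> A \<cdot> f" B] by (auto simp: D_of_L_def arrow_defs)
  show "\<langle>\<one> A, \<zero> A A\<rangle> \<cdot> D f = \<zero> A B"
    using f by (intro D_at_zero) (auto simp: mem_Hom_iff)
next
  fix A assume "A \<in> Obj X"
  then show "D (\<one> A) = \<pi>\<^sub>1 A A"
    by (simp add: D_of_L_def arrow_defs)
next
  fix A B assume "A \<in> Obj X" "B \<in> Obj X"
  then show "D (\<pi>\<^sub>0 A B) = \<pi>\<^sub>1 (A \<otimes> B) (A \<otimes> B) \<cdot> \<pi>\<^sub>0 A B"
    and "D (\<pi>\<^sub>1 A B) = \<pi>\<^sub>1 (A \<otimes> B) (A \<otimes> B) \<cdot> \<pi>\<^sub>1 A B"
    by (simp_all add: D_of_L_def arrow_defs)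
next
  fix f g A B C assume "f \<in> Hom A B" "g \<in> Hom A C"
  then show "D \<langle>f, g\<rangle> = \<langle>D f, D g\<rangle>"
    by (auto simp: D_of_L_def arrow_defs)
next
  fix f g A B C assume "f \<in> Hom A B" "g \<in> Hom B C"
  then show "D (f \<cdot> g) = \<langle>\<pi>\<^sub>0 A A \<cdot> f, D f\<rangle> \<cdot> D g"
    by (rule D_cmp)
next
  fix f A B assume f: "f \<in> Hom A B"
  let ?P = "A \<otimes> A" and ?R = "(A \<otimes> A) \<otimes> (A \<otimes> A)"
  have [simp]: "A \<in> Obj X" "B \<in> Obj X" and Df: "D f \<in> Hom ?P B"
    using f by (auto simp: mem_Hom_iff)
  have "\<langle>\<langle>\<pi>\<^sub>0 A A, \<zero> ?P A\<rangle>, \<langle>\<zero> ?P A, \<pi>\<^sub>1 A A\<rangle>\<rangle> \<cdot> D (D f) = \<langle>\<pi>\<^sub>0 A A, \<pi>\<^sub>1 A A\<rangle> \<cdot> D f"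
    by (intro D_partial1_linear[OF _ _ Df L_D[OF f]]) (simp_all add: mem_Hom_iff)
  then show "\<ell> A A A A \<cdot> D (D f) = D f"
    using f by (simp add: lift_arr_def arrow_defs)
  let ?p = "\<pi>\<^sub>0 ?P ?P" and ?q = "\<pi>\<^sub>1 ?P ?P"
  have "\<langle>\<langle>?p \<cdot> \<pi>\<^sub>0 A A, ?q \<cdot> \<pi>\<^sub>0 A A\<rangle>, \<langle>?p \<cdot> \<pi>\<^sub>1 A A, ?q \<cdot> \<pi>\<^sub>1 A A\<rangle>\<rangle> \<cdot> D (D f) =
      \<langle>\<langle>?p \<cdot> \<pi>\<^sub>0 A A, ?p \<cdot> \<pi>\<^sub>1 A A\<rangle>, \<langle>?q \<cdot> \<pi>\<^sub>0 A A, ?q \<cdot> \<pi>\<^sub>1 A A\<rangle>\<rangle> \<cdot> D (D f)"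
    by (intro D_D_symmetric[OF f, of _ ?R]) (simp_all add: mem_Hom_iff)
  then show "\<c> A A A A \<cdot> D (D f) = D (D f)"
    using f by (simp add: interchange_arr_def arrow_defs pairing_eta)
qed

text \<open>
  Both sides are the linearization of \<open>f\<close> itself: \<open>D f (0, a) = L[y \<mapsto> f(0 + y)](a)\<close>, and the
  parameter \<open>0\<close> is the value of a map out of the terminal object.
\<close>

lemma total_L_eq_L_of_D:
  assumes f: "f \<in> Hom A B"
  shows "total_L X L f = L_of_D X D f"
proof -
  have [simp]: "A \<in> Obj X" "B \<in> Obj X"
    using f by (auto simp: mem_Hom_iff)
  have "\<langle>\<zero> A \<top> \<cdot> \<zero> \<top> A, \<one> A\<rangle> \<cdot> L A A ((\<pi>\<^sub>0 A A \<boxplus> \<pi>\<^sub>1 A A) \<cdot> f) =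
      \<langle>\<zero> A \<top>, \<one> A\<rangle> \<cdot>
        L \<top> A (\<langle>\<pi>\<^sub>0 \<top> A \<cdot> \<zero> \<top> A, \<pi>\<^sub>1 \<top> A\<rangle> \<cdot> ((\<pi>\<^sub>0 A A \<boxplus> \<pi>\<^sub>1 A A) \<cdot> f))"
    using f by (intro L_reindex[where B = B and T = A]) (simp_all add: mem_Hom_iff)
  then show ?thesis
    using f by (simp add: total_L_def L_of_D_def D_eq_L[OF f] mem_Hom_iff)
qed

end

theorem proposition5p13:
  fixes X :: "('o, 'm, 'r) cartesian_left_additive_data_scheme"  (structure)
    and L :: "'o \<Rightarrow> 'o \<Rightarrow> 'm \<Rightarrow> 'm"
  assumes "cartesian_left_additive_category X"
    and "system_of_linearizing_combinators X L"
  shows "cartesian_differential_category X (D_of_L X L) \<and>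
    (\<forall>A \<in> Obj X. \<forall>B \<in> Obj X. \<forall>f \<in> Hom A B. L A A (D_of_L X L f) = D_of_L X L f) \<and>
    (\<forall>C \<in> Obj X. \<forall>A \<in> Obj X. \<forall>B \<in> Obj X. \<forall>f \<in> Hom (C \<otimes> A) B.
      linear_in_second X (D_of_L X L) C A f \<longleftrightarrow> L C A f = f) \<and>
    (\<forall>A \<in> Obj X. \<forall>B \<in> Obj X. \<forall>f \<in> Hom A B. total_L X L f = L_of_D X (D_of_L X L) f)"
proof -
  interpret system_of_linearizing_combinators X L
    by (fact assms(2))
  show ?thesis
    using cartesian_differential_category_D L_D linear_in_second_iff total_L_eq_L_of_D by blast
qed

end
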